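(* Let $G$ be a group. Then $\mathcal{P}(G)$ is a ring graph if and only if $\omega(G)\subseteq\{1,2,3\}$, and $\mathcal{P}^*(G)$ is a ring graph if and only if $\omega(G)\subseteq\{1,2,3,4\}$.
   Context: The power graph $\mathcal{P}(G)$ of a group $G$ is the simple graph with vertex set $G$ in which two distinct vertices $x,y$ are adjacent if and only if $x\in\langle y\rangle$ or $y\in\langle x\rangle$. The proper power graph $\mathcal{P}^*(G)$ is obtained from $\mathcal{P}(G)$ by deleting the identity element. $\omega(G)=\{|x| : x\in G\}$ is the set of orders of all elements of $G$. A chord of a cycle in a graph is an edge of the graph joining two vertices of the cycle that are not adjacent in the cycle; a cycle with no chord is a primitive cycle. A graph $\Gamma$ satisfies the primitive cycle property (PCP) if any two (distinct) primitive cycles intersect in at most one edge. The free rank $\mathrm{frank}(\Gamma)$ is the number of primitive cycles of $\Gamma$, and the cycle rank is $\mathrm{rank}(\Gamma)=e-v+c$, where $v,e,c$ are the numbers of vertices, edges and connected components. A graph $\Gamma$ is a ring graph if one of the following equivalent conditions holds: $\mathrm{rank}(\Gamma)=\mathrm{frank}(\Gamma)$; or $\Gamma$ satisfies the PCP and does not contain a subdivision of $K_4$ as a subgraph. *)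

theory Defs
  imports "HOL-Algebra.Multiplicative_Group" "Graph_Theory.Kuratowski"
begin

text \<open>
  Following the Graph\_Theory entry, a simple graph is a symmetric loop-free
  pair digraph: an undirected edge \<open>{u, v}\<close> is represented by the two arcs
  \<open>(u, v)\<close> and \<open>(v, u)\<close>. The graphs below may be infinite.
\<close>

definition power_graph :: "('a, 'm) monoid_scheme \<Rightarrow> 'a pair_pre_digraph" where
  "power_graph G = \<lparr> pverts = carrier G,
     parcs = {(x, y). x \<in> carrier G \<and> y \<in> carrier G \<and> x \<noteq> y
                \<and> (x \<in> generate G {y} \<or> y \<in> generate G {x})} \<rparr>"

definition proper_power_graph :: "('a, 'm) monoid_scheme \<Rightarrow> 'a pair_pre_digraph" where
  "proper_power_graph G = \<lparr> pverts = pverts (power_graph G) - {\<one>\<^bsub>G\<^esub>},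
     parcs = {(x, y) \<in> parcs (power_graph G). x \<noteq> \<one>\<^bsub>G\<^esub> \<and> y \<noteq> \<one>\<^bsub>G\<^esub>} \<rparr>"

text \<open>
  An element of infinite order contributes the value \<open>0\<close>, by the convention of
  \<^const>\<open>group.ord\<close>; so \<open>0\<close> plays the role of the order \<open>\<infinity>\<close>.
\<close>

definition element_orders :: "('a, 'm) monoid_scheme \<Rightarrow> nat set" where
  "element_orders G = group.ord G ` carrier G"


text \<open>
  The library's cycles in a symmetric digraph include the closed walks \<open>u, v, u\<close>;
  the length bound excludes them.
\<close>

definition graph_cycle :: "'a pair_pre_digraph \<Rightarrow> ('a \<times> 'a) list \<Rightarrow> bool" where
  "graph_cycle \<Gamma> p \<longleftrightarrow> pre_digraph.cycle (with_proj \<Gamma>) p \<and> 3 \<le> length p"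

definition cycle_verts :: "('a \<times> 'a) list \<Rightarrow> 'a set" where
  "cycle_verts p = fst ` set p"

definition cycle_edges :: "('a \<times> 'a) list \<Rightarrow> 'a set set" where
  "cycle_edges p = (\<lambda>(u, v). {u, v}) ` set p"

definition chord :: "'a pair_pre_digraph \<Rightarrow> ('a \<times> 'a) list \<Rightarrow> 'a \<times> 'a \<Rightarrow> bool" where
  "chord \<Gamma> p = (\<lambda>(u, v). (u, v) \<in> parcs \<Gamma> \<and> u \<in> cycle_verts p \<and> v \<in> cycle_verts p
     \<and> {u, v} \<notin> cycle_edges p)"

definition primitive_cycle :: "'a pair_pre_digraph \<Rightarrow> ('a \<times> 'a) list \<Rightarrow> bool" where
  "primitive_cycle \<Gamma> p \<longleftrightarrow> graph_cycle \<Gamma> p \<and> (\<nexists>e. chord \<Gamma> p e)"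

text \<open>
  Arc lists that differ by rotation or reversal describe the same cycle of the graph,
  so cycles are compared through their edge sets.
\<close>

definition PCP :: "'a pair_pre_digraph \<Rightarrow> bool" where
  "PCP \<Gamma> \<longleftrightarrow> (\<forall>p q. primitive_cycle \<Gamma> p \<and> primitive_cycle \<Gamma> q \<and> cycle_edges p \<noteq> cycle_edges q
     \<longrightarrow> card (cycle_edges p \<inter> cycle_edges q) \<le> 1)"

definition contains_K4_subdivision :: "'a pair_pre_digraph \<Rightarrow> bool" where
  "contains_K4_subdivision \<Gamma> \<longleftrightarrow>
     (\<exists>K H :: 'a pair_pre_digraph. complete_digraph 4 (with_proj K) \<and> subdivision_pair K H
        \<and> subgraph (with_proj H) (with_proj \<Gamma>))"

text \<open>
  Of the two equivalent conditions defining ring graphs, this is the one that does not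
  count vertices, edges and components, and hence makes sense for infinite graphs.
\<close>

definition ring_graph :: "'a pair_pre_digraph \<Rightarrow> bool" where
  "ring_graph \<Gamma> \<longleftrightarrow> PCP \<Gamma> \<and> \<not> contains_K4_subdivision \<Gamma>"

end

theory Submission
  imports Defs
begin

text \<open>
  An element \<open>x\<close> whose order is none of \<open>1, 2, 3\<close> yields the clique \<open>\<one>, x, x\<inverse>, x\<^sup>2\<close> on four
  vertices, and if its order is not \<open>4\<close> either, then \<open>x, x\<inverse>, x\<^sup>2, x\<^sup>-\<^sup>2\<close> is a clique avoiding
  \<open>\<one>\<close>: all these elements lie in \<open>\<langle>x\<rangle> = \<langle>x\<inverse>\<rangle>\<close>, and \<open>\<langle>x\<^sup>2\<rangle> = \<langle>x\<^sup>-\<^sup>2\<rangle>\<close>. This also covers elements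
  of infinite order. A clique on four vertices is itself a subdivision of \<open>K\<^sub>4\<close>.

  Conversely, if the orders are as required, the graph is a disjoint union of windmills: triangles,
  single edges and isolated vertices, where the pieces of one component share at most one
  vertex, its centre. In the power graph the centre is \<open>\<one>\<close>, the triangles are
  \<open>\<one>, x, x\<inverse>\<close> with \<open>x\<close> of order \<open>3\<close>. In the proper power graph the centres are the
  involutions, the triangles are \<open>x\<^sup>2, x, x\<inverse>\<close> with \<open>x\<close> of order \<open>4\<close>, and the
  elements of order \<open>3\<close> form components \<open>x, x\<inverse>\<close>. In such a graph every cycle is a triangle, determined by
  any of its vertices other than the centre. As each edge has an end that is not a
  centre, distinct cycles share no edge (\<open>windmill_PCP\<close>). The four branch vertices of a subdivision
  of \<open>K\<^sub>4\<close> have degree \<open>3\<close>, hence would have to be distinct centres, but they lie in the same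
  component (\<open>windmill_no_K4\<close>).
\<close>

section \<open>Windmill graphs\<close>

text \<open>
  A form of the windmill shape that suffices for the argument: \<open>\<kappa>\<close> is constant on components, its
  fixed points are the centres, and a vertex \<open>x\<close> that is no centre is adjacent at most to \<open>\<kappa> x\<close>
  and to one partner \<open>\<tau> x\<close>. The value \<open>\<kappa> x\<close> need not be a vertex, as a component
  may have no centre, and several components may share it.
\<close>

definition windmill :: "('a \<Rightarrow> 'a) \<Rightarrow> ('a \<Rightarrow> 'a) \<Rightarrow> 'a pair_pre_digraph \<Rightarrow> bool" where
  "windmill \<kappa> \<tau> \<Gamma> \<longleftrightarrow> (\<forall>x y. (x, y) \<in> parcs \<Gamma> \<longrightarrow>
     (y, x) \<in> parcs \<Gamma> \<and> x \<noteq> y \<and> \<kappa> x = \<kappa> y \<and> (\<kappa> x \<noteq> x \<longrightarrow> y = \<kappa> x \<or> y = \<tau> x))"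

lemma windmillD:
  assumes "windmill \<kappa> \<tau> \<Gamma>" "(x, y) \<in> parcs \<Gamma>"
  shows "(y, x) \<in> parcs \<Gamma>" "x \<noteq> y" "\<kappa> x = \<kappa> y" "\<kappa> x \<noteq> x \<Longrightarrow> y = \<kappa> x \<or> y = \<tau> x"
  using assms unfolding windmill_def by blast+

section \<open>Cycles as sets of arcs\<close>

lemma pcas_verts:
  assumes "pcas u p v"
  shows "u # map snd p = map fst p @ [v]" "pawalk_verts u p = u # map snd p"
  using assms by (induction p arbitrary: u) auto

lemma pcas_closed:
  assumes "pcas u p v" "\<And>a b. (a, b) \<in> set p \<Longrightarrow> a \<in> S \<longleftrightarrow> b \<in> S"
  shows "\<forall>a \<in> fst ` set p. a \<in> S \<longleftrightarrow> u \<in> S"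
  using assms
proof (induction p arbitrary: u)
  case (Cons e es)
  then have "fst e = u" "pcas (snd e) es v" by auto
  moreover have "\<forall>a \<in> fst ` set es. a \<in> S \<longleftrightarrow> snd e \<in> S"
    using Cons.prems \<open>pcas (snd e) es v\<close> by (intro Cons.IH) auto
  moreover have "fst e \<in> S \<longleftrightarrow> snd e \<in> S"
    using Cons.prems(2)[of "fst e" "snd e"] by simp
  ultimately show ?case by auto
qed simp

text \<open>
  A cycle is given by arcs of the graph forming a permutation of its vertices, with no
  proper nonempty invariant set of vertices.
\<close>

lemma graph_cycle_arcs:
  assumes "graph_cycle \<Gamma> p"
  shows "set p \<subseteq> parcs \<Gamma>" "fst ` set p = snd ` set p"
    "inj_on fst (set p)" "inj_on snd (set p)" "3 \<le> card (cycle_verts p)"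
    "\<And>S x. \<lbrakk>\<And>a b. (a, b) \<in> set p \<Longrightarrow> a \<in> S \<longleftrightarrow> b \<in> S; x \<in> cycle_verts p; x \<in> S\<rbrakk>
      \<Longrightarrow> cycle_verts p \<subseteq> S"
proof -
  interpret pair_pre_digraph \<Gamma> .
  obtain u where w: "awalk u p u" and d: "distinct (tl (pawalk_verts u p))"
    and len: "3 \<le> length p"
    using assms unfolding graph_cycle_def pre_digraph.cycle_def by (auto simp: awalk_verts_with_proj_eq)
  have cas: "pcas u p u" and sub: "set p \<subseteq> parcs \<Gamma>"
    using w unfolding awalk_def by auto
  show "set p \<subseteq> parcs \<Gamma>" by (rule sub)
  have eq: "u # map snd p = map fst p @ [u]" using pcas_verts(1)[OF cas] .
  have ds: "distinct (map snd p)" using d pcas_verts(2)[OF cas] by simp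
  have "mset (u # map snd p) = mset (map fst p @ [u])" using eq by simp
  then have m: "mset (map snd p) = mset (map fst p)" by simp
  then have df: "distinct (map fst p)" using ds mset_eq_imp_distinct_iff by blast
  show "fst ` set p = snd ` set p" using mset_eq_setD[OF m] by simp
  show "inj_on fst (set p)" "inj_on snd (set p)" using df ds by (auto simp: distinct_map)
  show "3 \<le> card (cycle_verts p)"
    using distinct_card[OF df] len by (simp add: cycle_verts_def)
  show "cycle_verts p \<subseteq> S" if "\<And>a b. (a, b) \<in> set p \<Longrightarrow> a \<in> S \<longleftrightarrow> b \<in> S"
    "x \<in> cycle_verts p" "x \<in> S" for S x
    using pcas_closed[OF cas, of S] that unfolding cycle_verts_def by blast
qed

section \<open>Cycles of a windmill graph\<close>

text \<open>
  On a cycle through a vertex \<open>x\<close> that is no centre, \<open>x\<close> lies between \<open>\<kappa> x\<close> and \<open>\<tau> x\<close>, since it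
  has no other neighbours. Likewise \<open>\<tau> x\<close> lies between \<open>x\<close> and \<open>\<kappa> (\<tau> x) = \<kappa> x\<close>, which closes the
  cycle.
\<close>

lemma windmill_cycle:
  assumes W: "windmill \<kappa> \<tau> \<Gamma>" and C: "graph_cycle \<Gamma> p"
    and x: "x \<in> cycle_verts p" "\<kappa> x \<noteq> x"
  shows "cycle_edges p = {{\<kappa> x, x}, {x, \<tau> x}, {\<tau> x, \<kappa> x}}"
proof -
  note cyc = graph_cycle_arcs[OF C]
  note wm = windmillD[OF W]
  have arc: "(a, b) \<in> parcs \<Gamma>" if "(a, b) \<in> set p" for a b using cyc(1) that by blast
  have succ: "\<exists>b. (a, b) \<in> set p" if "a \<in> cycle_verts p" for a
    using that unfolding cycle_verts_def by force
  have pred: "\<exists>b. (b, a) \<in> set p" if "a \<in> cycle_verts p" for a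
    using that cyc(2) unfolding cycle_verts_def by force
  have vsucc: "b \<in> cycle_verts p" if "(a, b) \<in> set p" for a b
    using that cyc(2) unfolding cycle_verts_def by force
  have su: "b = b'" if "(a, b) \<in> set p" "(a, b') \<in> set p" for a b b'
    using inj_onD[OF cyc(3), of "(a, b)" "(a, b')"] that by simp
  have pu: "b = b'" if "(b, a) \<in> set p" "(b', a) \<in> set p" for a b b'
    using inj_onD[OF cyc(4), of "(b, a)" "(b', a)"] that by simp
  have no2: False if ab: "(a, b) \<in> set p" "(b, a) \<in> set p" for a b
  proof -
    have "cycle_verts p \<subseteq> {a, b}"
      using su pu ab vsucc[OF ab(1)] by (intro cyc(6)[of _ b]) blast+
    then have "card (cycle_verts p) \<le> card {a, b}" by (intro card_mono) auto
    also have "\<dots> \<le> 2" by (simp add: card_insert_if)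
    finally show False using cyc(5) by simp
  qed
  have tri: "cycle_edges p = {{\<kappa> z, z}, {z, y}, {y, \<kappa> z}}"
    if zy: "(\<kappa> z, z) \<in> set p" "(z, y) \<in> set p" "\<kappa> z \<noteq> z" for z y
  proof -
    obtain b where b: "(y, b) \<in> set p" using succ[OF vsucc[OF zy(2)]] by blast
    have yc: "y \<noteq> \<kappa> z" using no2 zy by blast
    have ky: "\<kappa> y = \<kappa> z" using wm(3)[OF arc[OF zy(2)]] by simp
    \<comment> \<open>The two possible neighbours of \<open>y\<close> are \<open>z\<close> and the common centre.\<close>
    have "z = \<tau> y" using wm(4)[OF wm(1)[OF arc[OF zy(2)]]] ky yc zy(3) by auto
    moreover have "b = \<kappa> y \<or> b = \<tau> y" using wm(4)[OF arc[OF b]] ky yc by auto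
    moreover have "b \<noteq> z" using no2 b zy(2) by blast
    ultimately have yb: "(y, \<kappa> z) \<in> set p" using b ky by auto
    have V: "cycle_verts p \<subseteq> {\<kappa> z, z, y}"
      using su pu zy yb vsucc[OF zy(2)] by (intro cyc(6)[of _ y]) blast+
    have "set p \<subseteq> {(\<kappa> z, z), (z, y), (y, \<kappa> z)}"
    proof (rule subrelI)
      fix a b
      assume ab: "(a, b) \<in> set p"
      then have "a \<in> cycle_verts p" unfolding cycle_verts_def by force
      then consider "a = \<kappa> z" | "a = z" | "a = y" using V by blast
      then show "(a, b) \<in> {(\<kappa> z, z), (z, y), (y, \<kappa> z)}"
        using su[OF ab] zy yb by cases auto
    qed
    then have "set p = {(\<kappa> z, z), (z, y), (y, \<kappa> z)}" using zy yb by blast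
    then show ?thesis unfolding cycle_edges_def by auto
  qed
  obtain a b where ab: "(a, x) \<in> set p" "(x, b) \<in> set p" using succ[OF x(1)] pred[OF x(1)] by blast
  have "a = \<kappa> x \<or> a = \<tau> x" using wm(4)[OF wm(1)[OF arc[OF ab(1)]]] x(2) by blast
  moreover have "b = \<kappa> x \<or> b = \<tau> x" using wm(4)[OF arc[OF ab(2)]] x(2) by blast
  moreover have "a \<noteq> b" using no2 ab by blast
  ultimately consider "a = \<kappa> x" "b = \<tau> x" | "a = \<tau> x" "b = \<kappa> x" "\<kappa> x \<noteq> \<tau> x" by auto
  then show ?thesis
  proof cases
    case 1
    then show ?thesis using tri[of x b] ab x(2) by simp
  next
    case 2
    \<comment> \<open>The cycle is traversed as \<open>\<tau> x, x, \<kappa> x\<close>; so the arc entering \<open>\<tau> x\<close> leaves the centre.\<close>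
    have k: "\<kappa> (\<tau> x) = \<kappa> x" using wm(3)[OF arc[OF ab(1)]] 2 by simp
    have t: "\<kappa> (\<tau> x) \<noteq> \<tau> x" using k 2 by simp
    have "\<tau> x \<in> cycle_verts p" using ab(1) 2 unfolding cycle_verts_def by force
    then obtain d where d: "(d, \<tau> x) \<in> set p" using pred by blast
    have "d \<noteq> x" using no2 d ab(1) 2 by blast
    moreover have "x = \<tau> (\<tau> x)" using wm(4)[OF arc[OF ab(1)]] 2 k t x(2) by auto
    moreover have "d = \<kappa> (\<tau> x) \<or> d = \<tau> (\<tau> x)" using wm(4)[OF wm(1)[OF arc[OF d]]] t by blast
    ultimately have "d = \<kappa> (\<tau> x)" by auto
    then have "cycle_edges p = {{\<kappa> x, \<tau> x}, {\<tau> x, x}, {x, \<kappa> x}}"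
      using tri[of "\<tau> x" x] d ab(1) 2 k t by simp
    then show ?thesis by (auto simp: insert_commute)
  qed
qed

lemma windmill_PCP:
  assumes W: "windmill \<kappa> \<tau> \<Gamma>"
  shows "PCP \<Gamma>"
  unfolding PCP_def
proof (intro allI impI)
  fix p q
  assume pq: "primitive_cycle \<Gamma> p \<and> primitive_cycle \<Gamma> q \<and> cycle_edges p \<noteq> cycle_edges q"
  then have C: "graph_cycle \<Gamma> p" "graph_cycle \<Gamma> q" by (auto simp: primitive_cycle_def)
  have verts: "e \<subseteq> cycle_verts r" if "graph_cycle \<Gamma> r" "e \<in> cycle_edges r" for e r
    using that graph_cycle_arcs(2)[of \<Gamma> r] unfolding cycle_edges_def cycle_verts_def by force
  have "cycle_edges p \<inter> cycle_edges q = {}"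
  proof (rule ccontr)
    assume "cycle_edges p \<inter> cycle_edges q \<noteq> {}"
    then obtain e where e: "e \<in> cycle_edges p" "e \<in> cycle_edges q" by blast
    then obtain a b where ab: "(a, b) \<in> parcs \<Gamma>" "e = {a, b}"
      using graph_cycle_arcs(1)[OF C(1)] unfolding cycle_edges_def by auto
    have "\<kappa> a = \<kappa> b" "a \<noteq> b" using windmillD[OF W ab(1)] by auto
    then have "\<kappa> a \<noteq> a \<or> \<kappa> b \<noteq> b" by metis
    then obtain x where x: "x \<in> e" "\<kappa> x \<noteq> x" using ab(2) by blast
    then have "x \<in> cycle_verts p" "x \<in> cycle_verts q" using verts C e by blast+
    then have "cycle_edges p = cycle_edges q"
      using windmill_cycle[OF W C(1) _ x(2)] windmill_cycle[OF W C(2) _ x(2)] by metis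
    then show False using pq by simp
  qed
  then show "card (cycle_edges p \<inter> cycle_edges q) \<le> 1" by simp
qed

section \<open>Subdivisions of the complete graph on four vertices\<close>

lemma subdivision_branch_degree:
  assumes "subdivision_pair K H" "v \<in> pverts K"
  shows "card {w. (v, w) \<in> parcs H} = card {w. (v, w) \<in> parcs K}"
  using assms
proof (induction rule: subdivision_pair_induct)
  case (divide e w H)
  obtain a b where e: "e = (a, b)" by (cases e)
  interpret H: pair_bidirected_digraph H
    using divide.hyps(3) by (rule bidirected_digraphI_subdivision)
  have ba: "(a, b) \<in> parcs H" "(b, a) \<in> parcs H" "a \<noteq> b"
    using divide.hyps(1) e H.arcs_symmetric H.no_loops' by auto
  have wn: "(v, w) \<notin> parcs H" for v using divide.hyps(2) H.in_arcsD2 by blast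
  have "v \<in> pverts H"
    using subdivision_verts_subset[OF divide.hyps(3)] divide.prems by simp
  then have "v \<noteq> w" using divide.hyps(2) by blast
  have swap: "card (insert w (N - {c})) = card N" if "c \<in> N" "w \<notin> N" for c and N :: "'a set"
  proof (cases "finite N")
    case True
    then show ?thesis using that card_Suc_Diff1[OF True that(1)] by simp
  next
    case False
    then show ?thesis by simp
  qed
  let ?N = "{u. (v, u) \<in> parcs H}"
  have "card {u. (v, u) \<in> parcs (subdivide H e w)} = card ?N"
  proof -
    consider "v = a" | "v = b" | "v \<noteq> a" "v \<noteq> b" by blast
    then show ?thesis
    proof cases
      case 1
      then have "{u. (v, u) \<in> parcs (subdivide H e w)} = insert w (?N - {b})"
        using ba \<open>v \<noteq> w\<close> by (auto simp: e)
      then show ?thesis using swap[of b ?N] ba wn 1 by simp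
    next
      case 2
      then have "{u. (v, u) \<in> parcs (subdivide H e w)} = insert w (?N - {a})"
        using ba \<open>v \<noteq> w\<close> by (auto simp: e)
      then show ?thesis using swap[of a ?N] ba wn 2 by simp
    next
      case 3
      then have "{u. (v, u) \<in> parcs (subdivide H e w)} = ?N"
        using \<open>v \<noteq> w\<close> by (auto simp: e)
      then show ?thesis by simp
    qed
  qed
  then show ?case using divide by simp
qed simp

text \<open>Adjacent branch vertices stay in the same component, expressed by an arbitrary labelling.\<close>

lemma subdivision_label:
  assumes "subdivision_pair K H" "\<And>a b. (a, b) \<in> parcs H \<Longrightarrow> f a = f b" "(a, b) \<in> parcs K"
  shows "f a = f b"
  using assms
proof (induction rule: subdivision_pair_induct)
  case (divide e w H)
  obtain c d where e: "e = (c, d)" by (cases e)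
  have fw: "f c = f w" "f d = f w"
    using divide.prems(1)[of c w] divide.prems(1)[of d w] by (auto simp: e)
  have "f a' = f b'" if "(a', b') \<in> parcs H" for a' b'
    using divide.prems(1)[of a' b'] that fw
    by (cases "(a', b') = (c, d) \<or> (a', b') = (d, c)") (auto simp: e)
  then show ?case using divide by blast
qed

lemma windmill_no_K4:
  assumes W: "windmill \<kappa> \<tau> \<Gamma>"
  shows "\<not> contains_K4_subdivision \<Gamma>"
proof
  assume "contains_K4_subdivision \<Gamma>"
  then obtain K H :: "'a pair_pre_digraph" where K: "complete_digraph 4 (with_proj K)"
    and s: "subdivision_pair K H" and "subgraph (with_proj H) (with_proj \<Gamma>)"
    unfolding contains_K4_subdivision_def by blast
  then have sub: "parcs H \<subseteq> parcs \<Gamma>" by (auto simp: subgraph_def)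
  have V: "finite (pverts K)" "card (pverts K) = 4"
    "parcs K = {(u, v). (u, v) \<in> pverts K \<times> pverts K \<and> u \<noteq> v}"
    using K unfolding complete_digraph_pair_def by auto
  have centre: "\<kappa> v = v" if v: "v \<in> pverts K" for v
  proof (rule ccontr)
    assume "\<kappa> v \<noteq> v"
    then have "{w. (v, w) \<in> parcs H} \<subseteq> {\<kappa> v, \<tau> v}" using windmillD(4)[OF W] sub by blast
    then have "card {w. (v, w) \<in> parcs H} \<le> card {\<kappa> v, \<tau> v}" by (intro card_mono) auto
    also have "\<dots> \<le> 2" by (simp add: card_insert_if)
    finally have "card {w. (v, w) \<in> parcs K} \<le> 2" using subdivision_branch_degree[OF s v] by simp
    moreover have "{w. (v, w) \<in> parcs K} = pverts K - {v}" using V(3) v by auto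
    ultimately show False using V v by simp
  qed
  obtain a where a: "a \<in> pverts K" using V(2) by fastforce
  have "pverts K \<noteq> {a}" using V(2) by auto
  then obtain b where b: "b \<in> pverts K" "b \<noteq> a" using a by blast
  have "\<kappa> a = \<kappa> b"
  proof (rule subdivision_label[OF s, of \<kappa>])
    show "\<kappa> c = \<kappa> d" if "(c, d) \<in> parcs H" for c d using windmillD(3)[OF W] sub that by blast
    show "(a, b) \<in> parcs K" using V(3) a b by blast
  qed
  then show False using centre a b by simp
qed

lemma windmill_ring_graph: "windmill \<kappa> \<tau> \<Gamma> \<Longrightarrow> ring_graph \<Gamma>"
  by (simp add: ring_graph_def windmill_PCP windmill_no_K4)

lemma clique4_contains_K4_subdivision:
  assumes wf: "pair_wf_digraph \<Gamma>" and S: "S \<subseteq> pverts \<Gamma>" "card S = 4"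
    and clique: "\<And>x y. \<lbrakk>x \<in> S; y \<in> S; x \<noteq> y\<rbrakk> \<Longrightarrow> (x, y) \<in> parcs \<Gamma>"
  shows "contains_K4_subdivision \<Gamma>"
proof -
  define K where "K = \<lparr>pverts = S, parcs = {(u, v). (u, v) \<in> S \<times> S \<and> u \<noteq> v}\<rparr>"
  have "finite S" using S(2) card.infinite by fastforce
  then have K: "complete_digraph 4 (with_proj K)"
    unfolding complete_digraph_pair_def using S(2) by (simp add: K_def)
  then interpret K: pair_graph K by (rule pair_graphI_complete)
  have "subdivision_pair K K" by (rule subdivision_pair_base) unfold_locales
  moreover have "subgraph (with_proj K) (with_proj \<Gamma>)"
    unfolding subgraph_def wf_digraph_wp_iff using S clique wf K.pair_wf_digraph
    by (auto simp: K_def)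
  ultimately show ?thesis using K unfolding contains_K4_subdivision_def by blast
qed

section \<open>Power graphs\<close>

lemma pair_wf_power_graph: "pair_wf_digraph (power_graph G)"
  by unfold_locales (auto simp: power_graph_def)

lemma pair_wf_proper_power_graph: "pair_wf_digraph (proper_power_graph G)"
  by unfold_locales (auto simp: proper_power_graph_def power_graph_def)

lemma dvd_small_nat:
  fixes d :: nat
  shows "d dvd 2 \<Longrightarrow> d \<in> {1, 2}" "d dvd 3 \<Longrightarrow> d \<in> {1, 3}" "d dvd 4 \<Longrightarrow> d \<in> {1, 2, 4}"
proof -
  show "d dvd 2 \<Longrightarrow> d \<in> {1, 2}" using dvd_imp_le[of d 2] by (auto simp: le_Suc_eq numeral_eq_Suc)
  show "d dvd 3 \<Longrightarrow> d \<in> {1, 3}"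
    using dvd_imp_le[of d 3] by (cases "d = 0"; cases "d = 1"; cases "d = 2"; cases "d = 3") auto
  show "d dvd 4 \<Longrightarrow> d \<in> {1, 2, 4}"
    using dvd_imp_le[of d 4]
    by (cases "d = 0"; cases "d = 1"; cases "d = 2"; cases "d = 3"; cases "d = 4") auto
qed

context group
begin

lemma generate_inv:
  assumes "x \<in> carrier G"
  shows "generate G {inv x} = generate G {x}"
proof -
  have *: "generate G {inv y} \<subseteq> generate G {y}" if "y \<in> carrier G" for y
    using that by (intro generate_subgroup_incl generate_is_subgroup) (auto intro: generate.inv)
  show ?thesis using *[of x] *[of "inv x"] assms by auto
qed

lemma square_in_generate: "x \<otimes> x \<in> generate G {x}"
  by (rule generate.eng) (auto intro: generate.incl)

lemma ord_dvd_of_square_eq_one: "\<lbrakk>x \<in> carrier G; x \<otimes> x = \<one>\<rbrakk> \<Longrightarrow> ord x dvd 2"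
  by (simp add: pow_eq_id[symmetric] numeral_2_eq_2)

lemma ord_dvd_of_square_eq_inv:
  assumes "x \<in> carrier G" "x \<otimes> x = inv x"
  shows "ord x dvd 3"
  using assms by (simp add: pow_eq_id[symmetric] numeral_3_eq_3)

lemma ord_dvd_of_square_eq_inv_square:
  assumes "x \<in> carrier G" "x \<otimes> x = inv (x \<otimes> x)"
  shows "ord x dvd 4"
proof -
  have "(x \<otimes> x) \<otimes> (x \<otimes> x) = \<one>" using assms r_inv[of "x \<otimes> x"] by simp
  moreover have "x [^] (4::nat) = (x \<otimes> x) \<otimes> (x \<otimes> x)"
    using assms by (simp add: numeral_eq_Suc m_assoc)
  ultimately show ?thesis using assms pow_eq_id by metis
qed

lemma distinct_small_powers:
  assumes x: "x \<in> carrier G" and o: "ord x \<notin> {1, 2, 3}"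
  shows "x \<noteq> \<one>" "x \<otimes> x \<noteq> \<one>" "x \<noteq> inv x" "x \<otimes> x \<noteq> x" "x \<otimes> x \<noteq> inv x"
proof -
  show 1: "x \<noteq> \<one>" using o by auto
  show 2: "x \<otimes> x \<noteq> \<one>"
    using ord_dvd_of_square_eq_one[OF x] dvd_small_nat(1)[of "ord x"] o by auto
  show "x \<noteq> inv x" using 2 x r_inv[OF x] by force
  show "x \<otimes> x \<noteq> x" using 1 x by simp
  show "x \<otimes> x \<noteq> inv x"
    using ord_dvd_of_square_eq_inv[OF x] dvd_small_nat(2)[of "ord x"] o by auto
qed

lemma power_graph_contains_K4:
  assumes x: "x \<in> carrier G" and o: "ord x \<notin> {1, 2, 3}"
  shows "contains_K4_subdivision (power_graph G)"
proof (rule clique4_contains_K4_subdivision[OF pair_wf_power_graph])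
  note d = distinct_small_powers[OF x o]
  let ?S = "{\<one>, x, inv x, x \<otimes> x}"
  show "?S \<subseteq> pverts (power_graph G)" using x by (auto simp: power_graph_def)
  have "\<one> \<noteq> inv x" using x d(1) by (metis inv_eq_1_iff)
  then show "card ?S = 4" using d x d[symmetric] by (auto simp: card_insert_if)
  have "y \<in> generate G {x}" if "y \<in> ?S" for y
    using that square_in_generate by (auto intro: generate.intros)
  then show "(a, b) \<in> parcs (power_graph G)" if "a \<in> ?S" "b \<in> ?S" "a \<noteq> b" for a b
    using that x generate_inv[OF x] generate.one[of G] by (auto simp: power_graph_def)
qed

lemma proper_power_graph_contains_K4:
  assumes x: "x \<in> carrier G" and o: "ord x \<notin> {1, 2, 3, 4}"
  shows "contains_K4_subdivision (proper_power_graph G)"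
proof (rule clique4_contains_K4_subdivision[OF pair_wf_proper_power_graph])
  have o': "ord x \<notin> {1, 2, 3}" and oi: "ord (inv x) \<notin> {1, 2, 3}" using o x by auto
  note d = distinct_small_powers[OF x o']
  have xi: "inv x \<in> carrier G" using x by simp
  note di = distinct_small_powers[OF xi oi]
  have sq: "x \<otimes> x \<noteq> inv x \<otimes> inv x"
    using ord_dvd_of_square_eq_inv_square[OF x] dvd_small_nat(3)[of "ord x"] o x
    by (auto simp: inv_mult_group)
  let ?S = "{x, inv x, x \<otimes> x, inv x \<otimes> inv x}"
  show "?S \<subseteq> pverts (proper_power_graph G)"
    using x d di by (auto simp: power_graph_def proper_power_graph_def)
  show "card ?S = 4" using d di x sq by (auto simp: card_insert_if)
  have g: "y \<in> generate G {x}" if "y \<in> ?S" for y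
    using that square_in_generate[of x] square_in_generate[of "inv x"] generate_inv[OF x]
    by (auto intro: generate.intros)
  \<comment> \<open>The one pair in which neither element generates \<open>\<langle>x\<rangle>\<close> consists of mutual inverses.\<close>
  have inv2: "inv x \<otimes> inv x \<in> generate G {x \<otimes> x}"
    using generate.inv[of "x \<otimes> x" "{x \<otimes> x}" G] x by (simp add: inv_mult_group)
  show "(a, b) \<in> parcs (proper_power_graph G)" if "a \<in> ?S" "b \<in> ?S" "a \<noteq> b" for a b
    using that x generate_inv[OF x] g[of a] g[of b] inv2 d di
    by (auto simp: power_graph_def proper_power_graph_def)
qed

section \<open>Groups with elements of small order\<close>

lemma generate_ord_le_4:
  assumes x: "x \<in> carrier G" and o: "ord x \<in> {1, 2, 3, 4}" and y: "y \<in> generate G {x}"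
  shows "y \<in> {\<one>, x, x \<otimes> x, inv x}"
proof -
  have o0: "ord x \<noteq> 0" using o by auto
  have "y \<in> {x [^] k |k. k \<in> {0..ord x - 1}}"
    using y unfolding generate_pow_nat[OF x o0] ord_elems_inf_carrier[OF x o0] .
  then obtain k where k: "y = x [^] k" "k \<le> ord x - 1" by auto
  have sq: "x [^] (2::nat) = x \<otimes> x" using x by (simp add: numeral_2_eq_2)
  have cube: "x [^] (3::nat) = inv x" if "ord x = 4"
  proof -
    have "x [^] (3::nat) \<otimes> x = \<one>"
      using pow_ord_eq_1[OF x] nat_pow_Suc[of x 3] unfolding that by simp
    then show ?thesis using x inv_equality by simp
  qed
  consider "k = 0" | "k = 1" | "k = 2" | "k = 3" "ord x = 4" using k(2) o by force
  then show ?thesis using k(1) x sq cube by cases auto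
qed

lemma square_of_ord_3:
  assumes "x \<in> carrier G" "ord x = 3"
  shows "x \<otimes> x = inv x"
proof -
  have "(x \<otimes> x) \<otimes> x = \<one>" using pow_ord_eq_1[OF assms(1)] assms by (simp add: numeral_3_eq_3)
  then show ?thesis using assms inv_equality by simp
qed

lemma square_of_ord_2:
  assumes "x \<in> carrier G" "ord x = 2"
  shows "x \<otimes> x = \<one>"
  using pow_ord_eq_1[OF assms(1)] assms by (simp add: numeral_2_eq_2)

lemma ord_square_of_ord_4:
  assumes "x \<in> carrier G" "ord x = 4"
  shows "ord (x \<otimes> x) = 2"
proof -
  have "x [^] (2::nat) = x \<otimes> x" using assms by (simp add: numeral_2_eq_2)
  then show ?thesis using ord_pow[OF assms(1), of 2] assms by simp
qed

lemma generate_ord_le_4_cases: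
  assumes x: "x \<in> carrier G" and o: "ord x \<in> {1, 2, 3, 4}"
    and y: "y \<in> generate G {x}" "y \<noteq> x" "y \<noteq> \<one>"
  shows "y = inv x \<or> ord x = 4 \<and> y = x \<otimes> x \<and> ord y = 2"
proof -
  have "x = \<one>" if "ord x = 1" using that x ord_eq_1 by blast
  then show ?thesis
    using generate_ord_le_4[OF x o y(1)] y(2,3) o x square_of_ord_2 square_of_ord_3
      ord_square_of_ord_4 by auto
qed

lemma windmill_power_graph:
  assumes o: "element_orders G \<subseteq> {1, 2, 3}"
  shows "windmill (\<lambda>_. \<one>) (m_inv G) (power_graph G)"
proof -
  have *: "y = \<one> \<or> y = inv x" if "x \<in> carrier G" "y \<in> generate G {x}" "y \<noteq> x" for x y
  proof -
    have "ord x \<in> {1, 2, 3}" using o that(1) by (auto simp: element_orders_def)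
    then show ?thesis using generate_ord_le_4_cases[of x y] that by (cases "y = \<one>") auto
  qed
  have "y = \<one> \<or> y = inv x" if "(x, y) \<in> parcs (power_graph G)" "x \<noteq> \<one>" for x y
    using that *[of x y] *[of y x] by (auto simp: power_graph_def)
  then show ?thesis unfolding windmill_def by (auto simp: power_graph_def)
qed

text \<open>
  The elements of order \<open>3\<close> are mapped to \<open>\<one>\<close>, which is no vertex of the proper power graph:
  their components are single edges without a centre.
\<close>

lemma windmill_proper_power_graph:
  assumes o: "element_orders G \<subseteq> {1, 2, 3, 4}"
  shows "windmill (\<lambda>x. if ord x = 4 then x \<otimes> x else if ord x = 2 then x else \<one>)
    (m_inv G) (proper_power_graph G)" (is "windmill ?\<kappa> _ _")
proof -
  have ox: "ord x \<in> {1, 2, 3, 4}" if "x \<in> carrier G" for x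
    using that o by (auto simp: element_orders_def)
  have kinv: "?\<kappa> (inv x) = ?\<kappa> x" if x: "x \<in> carrier G" for x
  proof -
    have "inv x \<otimes> inv x = x \<otimes> x" if "ord x = 4"
    proof -
      have "(x \<otimes> x) \<otimes> (x \<otimes> x) = \<one>"
        using square_of_ord_2[of "x \<otimes> x"] ord_square_of_ord_4[OF x that] x by simp
      then show ?thesis using x inv_equality[of "x \<otimes> x" "x \<otimes> x"] by (simp add: inv_mult_group)
    qed
    moreover have "inv x = x" if "ord x = 2"
      using square_of_ord_2[OF x that] x inv_equality by blast
    ultimately show ?thesis using x by simp
  qed
  have arcs: "x \<in> carrier G" "y \<in> carrier G" "x \<noteq> \<one>" "y \<noteq> \<one>" "x \<noteq> y"
    "y = inv x \<or> (ord x = 4 \<and> y = x \<otimes> x \<and> ord y = 2) \<or> (ord y = 4 \<and> x = y \<otimes> y \<and> ord x = 2)"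
    if "(x, y) \<in> parcs (proper_power_graph G)" for x y
  proof -
    show c: "x \<in> carrier G" "y \<in> carrier G" "x \<noteq> \<one>" "y \<noteq> \<one>" "x \<noteq> y"
      using that by (auto simp: power_graph_def proper_power_graph_def)
    have "x \<in> generate G {y} \<or> y \<in> generate G {x}"
      using that by (auto simp: power_graph_def proper_power_graph_def)
    then show "y = inv x \<or> (ord x = 4 \<and> y = x \<otimes> x \<and> ord y = 2)
      \<or> (ord y = 4 \<and> x = y \<otimes> y \<and> ord x = 2)"
      using generate_ord_le_4_cases[of x y] generate_ord_le_4_cases[of y x] c ox by auto
  qed
  show ?thesis
    unfolding windmill_def
  proof (intro allI impI conjI)
    fix x y
    assume xy: "(x, y) \<in> parcs (proper_power_graph G)"
    note a = arcs[OF xy]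
    show "(y, x) \<in> parcs (proper_power_graph G)"
      using xy by (auto simp: power_graph_def proper_power_graph_def)
    show "x \<noteq> y" by (rule a(5))
    show "?\<kappa> x = ?\<kappa> y" using a(6) kinv[OF a(1)] by auto
    show "y = ?\<kappa> x \<or> y = inv x" if "?\<kappa> x \<noteq> x" using a(6) that by auto
  qed
qed

end

theorem theorem2p4:
  fixes G :: "('a, 'm) monoid_scheme"
  assumes "group G"
  shows "(ring_graph (power_graph G) \<longleftrightarrow> element_orders G \<subseteq> {1, 2, 3}) \<and>
         (ring_graph (proper_power_graph G) \<longleftrightarrow> element_orders G \<subseteq> {1, 2, 3, 4})"
proof -
  interpret group G by fact
  have "element_orders G \<subseteq> {1, 2, 3}" if "ring_graph (power_graph G)"
    using that power_graph_contains_K4 unfolding ring_graph_def element_orders_def by blast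
  moreover have "element_orders G \<subseteq> {1, 2, 3, 4}" if "ring_graph (proper_power_graph G)"
    using that proper_power_graph_contains_K4 unfolding ring_graph_def element_orders_def by blast
  ultimately show ?thesis
    using windmill_ring_graph[OF windmill_power_graph]
      windmill_ring_graph[OF windmill_proper_power_graph] by blast
qed

end
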